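(* Let $n\ge1$. The function \[ \mu^{\mathrm{Symm}(n,\mathbb{R})}:\mathscr{S}_n\to\mathrm{Symm}(n,\mathbb{R}),\qquad \mu^{\mathrm{Symm}(n,\mathbb{R})}(Z)=-2\,\mathrm{Im}(Z)^{-1}, \] is a moment map for the Parabolic Action $\mathrm{Symm}(n,\mathbb{R})\times\mathscr{S}_n\to\mathscr{S}_n$, $S\cdot Z=Z+S$, with respect to the K\"ahler form $\omega^{\mathscr{S}_n}$.
   Context: $\mathscr{S}_n=\{Z\in\mathrm{Symm}(n,\mathbb{C}) : \mathrm{Im}(Z)>0\}$, with entrywise real and imaginary parts. Its K\"ahler form is $\omega=-2\,\mathrm{Im}(g)$, with $g$ the Bergman metric $g=\frac{4}{n+1}\sum\frac{\partial^2\log K(Z,Z)}{\partial z_{lm}\partial\overline{z}_{jk}}dz_{lm}\otimes d\overline{z}_{jk}$ (sum over $l\le m$, $j\le k$), $K(Z,W)=\det(-i(Z-\overline{W}))^{-(n+1)}$; explicitly \[ \omega_Z(U,V)=2\,\mathrm{tr}\big(\mathrm{Im}(Z)^{-1}\mathrm{Re}(U)\mathrm{Im}(Z)^{-1}\mathrm{Im}(V)\big)-2\,\mathrm{tr}\big(\mathrm{Im}(Z)^{-1}\mathrm{Im}(U)\mathrm{Im}(Z)^{-1}\mathrm{Re}(V)\big),\quad U,V\in\mathrm{Symm}(n,\mathbb{C}). \] Moment map: for a Lie group $H$ with Lie algebra $\mathfrak{h}$ acting by symplectomorphisms on a symplectic manifold $(M,\omega)$, a moment map is a smooth map $\mu:M\to\mathfrak{h}^*$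 such that (1) for every $X\in\mathfrak{h}$ the function $\mu_X(z)=\langle\mu(z),X\rangle$ satisfies $d\mu_X=\omega(X^\sharp,\cdot)$, where $X^\sharp_z=\frac{d}{ds}\big|_{s=0}\exp(sX)\cdot z$; and (2) $\mu(h\cdot z)=\mathrm{Ad}^*(h)(\mu(z))$ for all $h\in H$, $z\in M$ (for Abelian $H$: $\mu(h\cdot z)=\mu(z)$). Here $\mathrm{Symm}(n,\mathbb{R})$ is a group under addition, equal to its own Lie algebra with exponential map the identity, and its dual is identified with $\mathrm{Symm}(n,\mathbb{R})$ via the inner product $\langle A,B\rangle=\mathrm{tr}(AB)$. *)

theory Defs
  imports "HOL-Analysis.Analysis"
begin

section \<open>Smooth maps on open subsets of a linear subspace\<close>

definition dir_deriv ::
  "('a::real_normed_vector \<Rightarrow> 'b::real_normed_vector) \<Rightarrow> 'a \<Rightarrow> 'a \<Rightarrow> 'b" where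
  "dir_deriv f z u = vector_derivative (\<lambda>t::real. f (z + t *\<^sub>R u)) (at 0)"

text \<open>
  \<open>M\<close> is meant to be relatively open in the linear subspace \<open>E\<close>.  The derivative \<open>D z\<close> along
  \<open>M\<close> is then determined on \<open>E\<close> only, which is why just the directions \<open>v \<in> E\<close> are
  differentiated further.
\<close>

primrec Ck_on ::
  "nat \<Rightarrow> 'a::real_normed_vector set \<Rightarrow> 'a set \<Rightarrow> ('a \<Rightarrow> 'b::real_normed_vector) \<Rightarrow> bool" where
  "Ck_on 0 E M f \<longleftrightarrow> continuous_on M f"
| "Ck_on (Suc k) E M f \<longleftrightarrow>
     (\<exists>D. (\<forall>z\<in>M. (f has_derivative D z) (at z within M)) \<and>
          (\<forall>v\<in>E. Ck_on k E M (\<lambda>z. D z v)))"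

definition smooth_map_on ::
  "'a::real_normed_vector set \<Rightarrow> 'a set \<Rightarrow> ('a \<Rightarrow> 'b::real_normed_vector) \<Rightarrow> bool" where
  "smooth_map_on E M f \<longleftrightarrow> (\<forall>k. Ck_on k E M f)"

section \<open>Symplectic manifolds, symplectic actions and moment maps\<close>

text \<open>
  The manifold \<open>M\<close> is an open subset of the linear space \<open>E\<close>, so every tangent space is \<open>E\<close>.
  The last conjunct is \<open>d\<omega> = 0\<close>, evaluated on constant vector fields.
\<close>

definition symplectic_manifold ::
  "'a::real_normed_vector set \<Rightarrow> 'a set \<Rightarrow> ('a \<Rightarrow> 'a \<Rightarrow> 'a \<Rightarrow> real) \<Rightarrow> bool" where
  "symplectic_manifold E M \<omega> \<longleftrightarrow>
     subspace E \<and> openin (top_of_set E) M \<and>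
     (\<forall>z\<in>M. \<forall>u\<in>E. \<forall>v\<in>E. \<forall>w\<in>E. \<forall>a b.
        \<omega> z (a *\<^sub>R u + b *\<^sub>R v) w = a * \<omega> z u w + b * \<omega> z v w) \<and>
     (\<forall>z\<in>M. \<forall>u\<in>E. \<forall>v\<in>E. \<omega> z u v = - \<omega> z v u) \<and>
     (\<forall>z\<in>M. \<forall>u\<in>E. (\<forall>v\<in>E. \<omega> z u v = 0) \<longrightarrow> u = 0) \<and>
     (\<forall>u\<in>E. \<forall>v\<in>E. smooth_map_on E M (\<lambda>z. \<omega> z u v)) \<and>
     (\<forall>z\<in>M. \<forall>u\<in>E. \<forall>v\<in>E. \<forall>w\<in>E.
        dir_deriv (\<lambda>y. \<omega> y v w) z u + dir_deriv (\<lambda>y. \<omega> y w u) z v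
          + dir_deriv (\<lambda>y. \<omega> y u v) z w = 0)"

text \<open>
  The acting Lie group is the additive group of a linear space \<open>H\<close>; it is its own Lie algebra,
  with the identity as exponential map.  The last conjunct says that each \<open>act a\<close> pulls \<open>\<omega>\<close>
  back to itself.
\<close>

definition symplectic_vector_group_action ::
  "'h::real_normed_vector set \<Rightarrow> ('h \<Rightarrow> 'a::real_normed_vector \<Rightarrow> 'a) \<Rightarrow>
   'a set \<Rightarrow> 'a set \<Rightarrow> ('a \<Rightarrow> 'a \<Rightarrow> 'a \<Rightarrow> real) \<Rightarrow> bool" where
  "symplectic_vector_group_action H act E M \<omega> \<longleftrightarrow>
     subspace H \<and>
     (\<forall>a\<in>H. \<forall>z\<in>M. act a z \<in> M) \<and>
     (\<forall>z\<in>M. act 0 z = z) \<and>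
     (\<forall>a\<in>H. \<forall>b\<in>H. \<forall>z\<in>M. act (a + b) z = act a (act b z)) \<and>
     smooth_map_on (H \<times> E) (H \<times> M) (\<lambda>(a, z). act a z) \<and>
     (\<forall>a\<in>H. \<forall>z\<in>M. \<forall>u\<in>E. \<forall>v\<in>E.
        \<omega> (act a z) (dir_deriv (act a) z u) (dir_deriv (act a) z v) = \<omega> z u v)"

definition fundamental_field ::
  "('h::real_normed_vector \<Rightarrow> 'a::real_normed_vector \<Rightarrow> 'a) \<Rightarrow> 'h \<Rightarrow> 'a \<Rightarrow> 'a" where
  "fundamental_field act X z = vector_derivative (\<lambda>s::real. act (s *\<^sub>R X) z) (at 0)"

text \<open>
  The dual of \<open>H\<close> is identified with \<open>H\<close> by the inner product \<open>pair\<close>, so \<open>\<mu>\<close> is \<open>H\<close>-valued and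
  \<open>\<mu>\<^sub>X = (\<lambda>z. pair (\<mu> z) X)\<close>.  As \<open>H\<close> is Abelian, equivariance amounts to invariance.
\<close>

definition inner_product_on ::
  "'h::real_vector set \<Rightarrow> ('h \<Rightarrow> 'h \<Rightarrow> real) \<Rightarrow> bool" where
  "inner_product_on H pair \<longleftrightarrow>
     (\<forall>u\<in>H. \<forall>v\<in>H. \<forall>w\<in>H. \<forall>a b.
        pair (a *\<^sub>R u + b *\<^sub>R v) w = a * pair u w + b * pair v w) \<and>
     (\<forall>u\<in>H. \<forall>v\<in>H. pair u v = pair v u) \<and>
     (\<forall>u\<in>H. u \<noteq> 0 \<longrightarrow> pair u u > 0)"

definition moment_map ::
  "'h::real_normed_vector set \<Rightarrow> ('h \<Rightarrow> 'h \<Rightarrow> real) \<Rightarrow>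
   ('h \<Rightarrow> 'a::real_normed_vector \<Rightarrow> 'a) \<Rightarrow>
   'a set \<Rightarrow> 'a set \<Rightarrow> ('a \<Rightarrow> 'a \<Rightarrow> 'a \<Rightarrow> real) \<Rightarrow> ('a \<Rightarrow> 'h) \<Rightarrow> bool" where
  "moment_map H pair act E M \<omega> \<mu> \<longleftrightarrow>
     symplectic_manifold E M \<omega> \<and>
     symplectic_vector_group_action H act E M \<omega> \<and>
     inner_product_on H pair \<and>
     (\<forall>z\<in>M. \<mu> z \<in> H) \<and>
     smooth_map_on E M \<mu> \<and>
     (\<forall>X\<in>H. \<forall>z\<in>M. \<exists>D.
        ((\<lambda>y. pair (\<mu> y) X) has_derivative D) (at z within M) \<and>
        (\<forall>v\<in>E. D v = \<omega> z (fundamental_field act X z) v)) \<and>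
     (\<forall>h\<in>H. \<forall>z\<in>M. \<mu> (act h z) = \<mu> z)"

section \<open>The Siegel upper half space and its Kaehler form\<close>

definition Symm :: "('a ^ 'n ^ 'n) set" where
  "Symm = {A. transpose A = A}"

definition siegel :: "(complex ^ 'n ^ 'n) set" where
  "siegel = {Z \<in> Symm. \<forall>x. x \<noteq> 0 \<longrightarrow> x \<bullet> (map_matrix Im Z *v x) > 0}"

definition bergman_kernel ::
  "complex ^ 'n ^ 'n \<Rightarrow> complex ^ 'n ^ 'n \<Rightarrow> complex" where
  "bergman_kernel Z W =
     inverse (det (map_matrix (\<lambda>c. - \<i> * c) (Z - map_matrix cnj W)) ^ (CARD('n) + 1))"

text \<open>
  The complex coordinates of \<open>Symm\<close> are the entries \<open>z\<^bsub>lm\<^esub>\<close> with \<open>l \<le> m\<close>; the linear order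
  on the index type serves only to express this.  \<open>coord_vec c l m\<close> is the point all of whose
  coordinates vanish, except that \<open>z\<^bsub>lm\<^esub> = c\<close>.
\<close>

definition coord_vec :: "complex \<Rightarrow> 'n \<Rightarrow> 'n \<Rightarrow> complex ^ 'n ^ 'n" where
  "coord_vec c l m = (\<chi> i j. if (i = l \<and> j = m) \<or> (i = m \<and> j = l) then c else 0)"

definition d_dz ::
  "'n::finite \<Rightarrow> 'n \<Rightarrow> (complex ^ 'n ^ 'n \<Rightarrow> complex) \<Rightarrow> complex ^ 'n ^ 'n \<Rightarrow> complex" where
  "d_dz l m f Z = (dir_deriv f Z (coord_vec 1 l m) - \<i> * dir_deriv f Z (coord_vec \<i> l m)) / 2"

definition d_dzbar ::
  "'n::finite \<Rightarrow> 'n \<Rightarrow> (complex ^ 'n ^ 'n \<Rightarrow> complex) \<Rightarrow> complex ^ 'n ^ 'n \<Rightarrow> complex" where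
  "d_dzbar j k f Z = (dir_deriv f Z (coord_vec 1 j k) + \<i> * dir_deriv f Z (coord_vec \<i> j k)) / 2"

text \<open>On \<open>siegel\<close> the value \<open>K(Z,Z) = det (2 Im Z)\<^bsup>-(n+1)\<^esup>\<close> is a positive real number, so
  \<open>Ln\<close> is the real logarithm there.\<close>

definition bergman_metric ::
  "complex ^ 'n::{finite,linorder} ^ 'n::{finite,linorder} \<Rightarrow>
   complex ^ 'n::{finite,linorder} ^ 'n::{finite,linorder} \<Rightarrow>
   complex ^ 'n::{finite,linorder} ^ 'n::{finite,linorder} \<Rightarrow> complex" where
  "bergman_metric Z U V =
     4 / of_nat (CARD('n) + 1) *
     (\<Sum>(l, m) \<in> {(l, m). l \<le> m}. \<Sum>(j, k) \<in> {(j, k). j \<le> k}.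
        d_dz l m (d_dzbar j k (\<lambda>Y. Ln (bergman_kernel Y Y))) Z * (U $ l $ m) * cnj (V $ j $ k))"

definition kaehler_form ::
  "complex ^ 'n::{finite,linorder} ^ 'n::{finite,linorder} \<Rightarrow>
   complex ^ 'n::{finite,linorder} ^ 'n::{finite,linorder} \<Rightarrow>
   complex ^ 'n::{finite,linorder} ^ 'n::{finite,linorder} \<Rightarrow> real" where
  "kaehler_form Z U V = - 2 * Im (bergman_metric Z U V)"

definition parabolic_action ::
  "real ^ 'n ^ 'n \<Rightarrow> complex ^ 'n ^ 'n \<Rightarrow> complex ^ 'n ^ 'n" where
  "parabolic_action S Z = Z + map_matrix of_real S"

end

theory Submission
  imports Defs
begin

text \<open>
  Write \<open>F = Im(Z)\<^bsup>-1\<^esup>\<close>.  On \<open>siegel\<close> the potential \<open>log K(Z,Z)\<close> equals \<open>-(n+1) log det (Im Z)\<close> up to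
  a constant, so Jacobi's formula and \<open>dF(V) = -F Im(V) F\<close> yield the mixed second derivatives
  \<open>(n+1)/4 tr (F E\<^bsub>lm\<^esub> F E\<^bsub>jk\<^esub>)\<close> and hence
  \<open>\<omega>(U,V) = 2 tr (F Re(U) F Im(V)) - 2 tr (F Im(U) F Re(V))\<close>.
  The moment map equation is \<open>d(-2 tr (F X))(V) = 2 tr (F X F Im(V)) = \<omega>(X,V)\<close>.  Everything depends on
  \<open>Z\<close> through \<open>Im(Z)\<close> only, which the action leaves fixed.
\<close>

section \<open>Derivatives of the determinant and of the matrix inverse\<close>

text \<open>\<open>siegel\<close> is open only relative to \<open>Symm\<close>, and the formulas for
  \<open>Ln (bergman_kernel Z Z)\<close> and its derivatives hold only on \<open>siegel\<close>.
  Derivatives are therefore taken within \<open>siegel\<close>, and \<open>dir_deriv_eq\<close>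
  converts them to the directional derivatives of the definitions, which see only a line near its
  base point. The factor (n+1)/4 arises because the potential does not depend on Re(Z): on such
  functions d/dz and d/dzbar act as -i/2 and i/2 times the derivative in the imaginary direction. It
  cancels against the factor 4/(n+1) of the metric. Since \<open>moment_map\<close> includes the
  symplectic axioms, nondegeneracy and closedness of the form have to be shown too. For the first,
  the direction i Y U Y with Y = Im(Z) detects U; the second rests on the symmetry of the triple
  traces that appear when the form is differentiated.\<close>

lemma matrix_inv_right_left:
  fixes A :: "real ^ 'n ^ 'n"
  assumes "invertible A"
  shows "A ** matrix_inv A = mat 1" "matrix_inv A ** A = mat 1"
proof -
  have "A ** matrix_inv A = mat 1 \<and> matrix_inv A ** A = mat 1"
    using assms unfolding invertible_def matrix_inv_def by (rule someI_ex)
  then show "A ** matrix_inv A = mat 1" "matrix_inv A ** A = mat 1" by auto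
qed

lemma trace_scaleR: "trace (c *\<^sub>R A) = c * trace (A :: real ^ 'n ^ 'n)"
  by (simp add: trace_def sum_distrib_left)

lemma trace_transpose: "trace (transpose A) = trace A"
  by (simp add: trace_def transpose_def)

lemma trace_zero [simp]: "trace 0 = 0"
  by (simp add: trace_def)

lemma trace_uminus: "trace (- A) = - trace (A :: real ^ 'n ^ 'n)"
  by (simp add: trace_def sum_negf)

lemma bounded_bilinear_matrix_matrix_mult:
  "bounded_bilinear ((**) :: real ^ 'n ^ 'm \<Rightarrow> real ^ 'p ^ 'n \<Rightarrow> real ^ 'p ^ 'm)"
  unfolding bilinear_conv_bounded_bilinear[symmetric] bilinear_def
  by (auto intro!: linearI simp: vec_eq_iff matrix_matrix_mult_def sum.distrib sum_distrib_left algebra_simps)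

lemma bounded_bilinear_matrix_vector_mult:
  "bounded_bilinear ((*v) :: real ^ 'n ^ 'm \<Rightarrow> real ^ 'n \<Rightarrow> real ^ 'm)"
  unfolding bilinear_conv_bounded_bilinear[symmetric] bilinear_def
  by (auto intro!: linearI simp: vec_eq_iff matrix_vector_mult_def sum.distrib sum_distrib_left algebra_simps)

lemma bounded_linear_trace: "bounded_linear (trace :: real ^ 'n ^ 'n \<Rightarrow> real)"
  unfolding linear_conv_bounded_linear[symmetric]
  by (auto intro!: linearI simp: trace_add trace_scaleR)

lemmas matrix_mult_minus_left = bounded_bilinear.minus_left[OF bounded_bilinear_matrix_matrix_mult]
lemmas matrix_mult_minus_right = bounded_bilinear.minus_right[OF bounded_bilinear_matrix_matrix_mult]
lemmas matrix_mult_add_left = bounded_bilinear.add_left[OF bounded_bilinear_matrix_matrix_mult]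
lemmas matrix_mult_add_right = bounded_bilinear.add_right[OF bounded_bilinear_matrix_matrix_mult]
lemmas matrix_mult_scaleR_left = bounded_bilinear.scaleR_left[OF bounded_bilinear_matrix_matrix_mult]
lemmas matrix_mult_scaleR_right = bounded_bilinear.scaleR_right[OF bounded_bilinear_matrix_matrix_mult]

lemma continuous_det: "continuous (at A) (det :: real ^ 'n ^ 'n \<Rightarrow> real)"
  unfolding det_def continuous_at by (intro tendsto_intros)

text \<open>Each column of the inverse solves a linear system whose right-hand side is a basis
  vector, so Cramer's rule applies. Continuity of the inverse is thereby reduced to continuity of
  \<open>det\<close>.\<close>

lemma matrix_inv_cramer:
  fixes A :: "real ^ 'n ^ 'n"
  assumes "det A \<noteq> 0"
  shows "matrix_inv A =
    (\<chi> k m. det (\<chi> i j. if j = k then axis m 1 $ i else A $ i $ j) / det A)"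
proof -
  have "A *v (matrix_inv A *v axis m 1) = axis m 1" for m
    using assms by (simp add: matrix_vector_mul_assoc matrix_inv_right_left invertible_det_nz)
  then have "matrix_inv A *v axis m 1 =
      (\<chi> k. det (\<chi> i j. if j = k then axis m 1 $ i else A $ i $ j) / det A)" for m
    using cramer[OF assms] by blast
  then show ?thesis
    by (simp add: vec_eq_iff matrix_vector_mult_basis column_def)
qed

lemma eventually_det_nz:
  fixes A :: "real ^ 'n ^ 'n"
  assumes "det A \<noteq> 0"
  shows "\<forall>\<^sub>F B in nhds A. det B \<noteq> 0"
proof -
  have "(det \<longlongrightarrow> det A) (nhds A)"
    using continuous_det[of A] tendsto_nhds_iff[of det "det A" A] by (simp add: continuous_at)
  then show ?thesis using assms tendsto_imp_eventually_ne by blast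
qed

lemma tendsto_matrix_inv:
  fixes A :: "real ^ 'n ^ 'n"
  assumes "det A \<noteq> 0"
  shows "(matrix_inv \<longlongrightarrow> matrix_inv A) (at A)"
proof -
  let ?C = "\<lambda>B::real^'n^'n. \<chi> k m. det (\<chi> i j. if j = k then axis m 1 $ i else B $ i $ j) / det B"
  have lim: "(?C \<longlongrightarrow> ?C A) (at A)"
  proof (intro vec_tendstoI)
    fix k m
    have "((\<lambda>B. \<chi> i j. if j = k then axis m 1 $ i else B $ i $ j) \<longlongrightarrow>
        (\<chi> i j. if j = k then axis m 1 $ i else A $ i $ j)) (at A)"
      by (intro vec_tendstoI) (auto intro!: tendsto_intros)
    then have "((\<lambda>B. det (\<chi> i j. if j = k then axis m 1 $ i else B $ i $ j)) \<longlongrightarrow>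
        det (\<chi> i j. if j = k then axis m 1 $ i else A $ i $ j)) (at A)"
      by (rule isCont_tendsto_compose[OF continuous_det])
    with assms show "((\<lambda>B. ?C B $ k $ m) \<longlongrightarrow> ?C A $ k $ m) (at A)"
      using continuous_det[of A] by (auto simp: continuous_at intro!: tendsto_divide)
  qed
  have ev: "\<forall>\<^sub>F B in at A. matrix_inv B = ?C B"
    unfolding eventually_at_filter
    by (rule eventually_mono[OF eventually_det_nz[OF assms]]) (blast intro: matrix_inv_cramer)
  show ?thesis
    unfolding matrix_inv_cramer[OF assms] by (rule iffD2[OF tendsto_cong[OF ev] lim])
qed

text \<open>With G the inverse of A, the identity X^-1 (X - A) G = G - X^-1 turns the error of the
  linear approximation into -(X^-1 - G) (X - A) G. This is of smaller order than X - A because the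
  inverse is continuous.\<close>

lemma has_derivative_matrix_inv:
  fixes A :: "real ^ 'n ^ 'n"
  assumes "det A \<noteq> 0"
  shows "(matrix_inv has_derivative (\<lambda>H. - (matrix_inv A ** H ** matrix_inv A))) (at A)"
proof -
  let ?G = "matrix_inv A"
  interpret mm: bounded_bilinear "(**) :: real^'n^'n \<Rightarrow> real^'n^'n \<Rightarrow> real^'n^'n"
    by (rule bounded_bilinear_matrix_matrix_mult)
  obtain K where K: "K > 0" "\<forall>(X :: real^'n^'n) (Y :: real^'n^'n). norm (X ** Y) \<le> norm X * norm Y * K"
    using mm.pos_bounded by (elim exE conjE)
  have lin: "bounded_linear (\<lambda>H. - (?G ** H ** ?G))"
    unfolding linear_conv_bounded_linear[symmetric]
    by (auto intro!: linearI simp: mm.add_left mm.add_right mm.scaleR_left mm.scaleR_right)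
  have inv: "X ** matrix_inv X = mat 1" "matrix_inv X ** X = mat 1"
    if "det X \<noteq> 0" for X :: "real^'n^'n"
    using that by (simp_all add: matrix_inv_right_left invertible_det_nz)
  have main: "norm (matrix_inv X - ?G - (- (?G ** (X - A) ** ?G)))
      \<le> norm (matrix_inv X - ?G) * (K * K * norm ?G) * norm (X - A)" if "det X \<noteq> 0" for X
  proof -
    have r: "matrix_inv X ** (X - A) ** ?G = ?G - matrix_inv X"
    proof -
      have "matrix_inv X ** (X - A) ** ?G = (matrix_inv X ** X) ** ?G - matrix_inv X ** (A ** ?G)"
        by (simp add: mm.diff_left mm.diff_right matrix_mul_assoc)
      also have "\<dots> = ?G - matrix_inv X" by (simp add: inv that assms)
      finally show ?thesis .
    qed
    have "matrix_inv X - ?G - (- (?G ** (X - A) ** ?G)) = - ((matrix_inv X - ?G) ** (X - A) ** ?G)"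
      using r by (simp add: mm.diff_left)
    then have "norm (matrix_inv X - ?G - (- (?G ** (X - A) ** ?G)))
        = norm ((matrix_inv X - ?G) ** (X - A) ** ?G)" by simp
    also have "\<dots> \<le> norm ((matrix_inv X - ?G) ** (X - A)) * norm ?G * K"
      using K(2) by blast
    also have "\<dots> \<le> (norm (matrix_inv X - ?G) * norm (X - A) * K) * norm ?G * K"
      using K by (intro mult_right_mono) auto
    finally show ?thesis by (simp add: ac_simps)
  qed
  have "((\<lambda>X. norm (matrix_inv X - ?G) * (K * K * norm ?G)) \<longlongrightarrow> norm (?G - ?G) * (K * K * norm ?G)) (at A)"
    by (intro tendsto_intros tendsto_matrix_inv assms)
  then have lim: "((\<lambda>X. norm (matrix_inv X - ?G) * (K * K * norm ?G)) \<longlongrightarrow> 0) (at A)" by simp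
  show ?thesis
    unfolding has_derivative_within_alt2
  proof (intro conjI lin allI impI)
    fix e :: real assume "e > 0"
    with lim have "\<forall>\<^sub>F X in at A. norm (matrix_inv X - ?G) * (K * K * norm ?G) < e"
      by (simp add: order_tendsto_iff)
    moreover have "\<forall>\<^sub>F X in at A. det X \<noteq> 0"
      using eventually_det_nz[OF assms] by (simp add: eventually_at_filter eventually_mono)
    ultimately show "\<forall>\<^sub>F y in at A. norm (matrix_inv y - ?G - - (?G ** (y - A) ** ?G)) \<le> e * norm (y - A)"
    proof eventually_elim
      case (elim X)
      then have "norm (matrix_inv X - ?G) * (K * K * norm ?G) * norm (X - A) \<le> e * norm (X - A)"
        by (intro mult_right_mono) auto
      with main[OF elim(2)] show ?case by linarith
    qed
  qed
qed

text \<open>A permutation other than the identity moves two indices, so its summand vanishes to second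
  order at the identity matrix.\<close>

lemma has_derivative_det_one: "((det :: real ^ 'n ^ 'n \<Rightarrow> real) has_derivative trace) (at (mat 1))"
proof -
  let ?I = "mat 1 :: real ^ 'n ^ 'n"
  let ?P = "{p. p permutes (UNIV :: 'n set)}"
  let ?D = "\<lambda>p (H :: real^'n^'n). \<Sum>i\<in>UNIV. H $ i $ p i * (\<Prod>j\<in>UNIV - {i}. ?I $ j $ p j)"
  have entry: "((\<lambda>A :: real^'n^'n. A $ i $ j) has_derivative (\<lambda>H. H $ i $ j)) (at ?I)" for i j
    using bounded_linear.has_derivative[OF bounded_linear_vec_nth
        bounded_linear.has_derivative[OF bounded_linear_vec_nth has_derivative_ident]] .
  have "((\<lambda>A :: real^'n^'n. \<Sum>p\<in>?P. of_int (sign p) * (\<Prod>i\<in>UNIV. A $ i $ p i)) has_derivative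
      (\<lambda>H. \<Sum>p\<in>?P. of_int (sign p) * ?D p H)) (at ?I)"
    by (rule has_derivative_sum, rule has_derivative_mult_right, rule has_derivative_prod, rule entry)
  moreover have "(\<Sum>p\<in>?P. of_int (sign p) * ?D p H) = trace H" for H
  proof -
    have "?D p H = 0" if "p \<in> ?P" "p \<noteq> id" for p
    proof (rule sum.neutral, rule ballI)
      fix i
      from that have "inj p" by (simp add: permutes_inj)
      have "\<exists>j. j \<noteq> i \<and> p j \<noteq> j"
      proof (rule ccontr)
        assume *: "\<nexists>j. j \<noteq> i \<and> p j \<noteq> j"
        have "p i = i"
        proof (rule ccontr)
          assume "p i \<noteq> i"
          then have "p (p i) = p i" using * by blast
          with \<open>inj p\<close> \<open>p i \<noteq> i\<close> show False by (auto dest: injD)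
        qed
        with * have "p = id" by (auto simp: fun_eq_iff)
        with that show False by simp
      qed
      then obtain j where "j \<noteq> i" "p j \<noteq> j" by blast
      then have "\<exists>j\<in>UNIV - {i}. ?I $ j $ p j = 0"
        by (intro bexI[of _ j]) (auto simp: mat_def)
      then have "(\<Prod>j\<in>UNIV - {i}. ?I $ j $ p j) = 0"
        by (intro prod_zero) auto
      then show "H $ i $ p i * (\<Prod>j\<in>UNIV - {i}. ?I $ j $ p j) = 0"
        by simp
    qed
    then have "(\<Sum>p\<in>?P. of_int (sign p) * ?D p H) = (\<Sum>p\<in>{id}. of_int (sign p) * ?D p H)"
      by (intro sum.mono_neutral_right) (auto simp: permutes_id finite_permutations)
    also have "\<dots> = trace H" by (simp add: trace_def mat_def)
    finally show ?thesis .
  qed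
  ultimately have "((\<lambda>A :: real^'n^'n. \<Sum>p\<in>?P. of_int (sign p) * (\<Prod>i\<in>UNIV. A $ i $ p i)) has_derivative trace) (at ?I)"
    by (simp only:)
  then show ?thesis unfolding det_def .
qed

text \<open>Jacobi's formula at A is the formula at the identity matrix, transported by det X = det
  A * det (A^-1 X).\<close>

lemma has_derivative_det:
  fixes A :: "real ^ 'n ^ 'n"
  assumes "det A \<noteq> 0"
  shows "(det has_derivative (\<lambda>H. det A * trace (matrix_inv A ** H))) (at A)"
proof -
  let ?G = "matrix_inv A"
  have inv: "A ** ?G = mat 1" "?G ** A = mat 1"
    using assms by (simp_all add: matrix_inv_right_left invertible_det_nz)
  have "((\<lambda>X. ?G ** X) has_derivative (\<lambda>H. ?G ** H)) (at A)"
    by (intro bounded_linear_imp_has_derivative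
        bounded_bilinear.bounded_linear_right[OF bounded_bilinear_matrix_matrix_mult])
  from has_derivative_compose[OF this, of det trace]
  have "((\<lambda>X. det A * det (?G ** X)) has_derivative (\<lambda>H. det A * trace (?G ** H))) (at A)"
    by (intro has_derivative_mult_right) (simp add: inv has_derivative_det_one)
  moreover have "det A * det (?G ** X) = det X" for X
    by (metis det_mul inv(1) matrix_mul_assoc matrix_mul_lid)
  ultimately show ?thesis by simp
qed

section \<open>Smooth maps\<close>

text \<open>All derivatives are taken within \<open>M\<close>, so only values on \<open>M\<close>
  matter. This allows a closed formula valid only on \<open>siegel\<close> to replace a
  definition.\<close>

lemma Ck_on_cong:
  assumes "\<And>z. z \<in> M \<Longrightarrow> f z = g z"
  shows "Ck_on k E M f \<longleftrightarrow> Ck_on k E M g"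
proof (cases k)
  case 0
  with assms show ?thesis by (simp cong: continuous_on_cong)
next
  case (Suc l)
  have "(f has_derivative D) (at z within M) \<longleftrightarrow> (g has_derivative D) (at z within M)"
    if "z \<in> M" for z D
    using has_derivative_transform[OF that] assms by metis
  with Suc show ?thesis by auto
qed

lemma Ck_on_Suc_imp: "Ck_on (Suc k) E M f \<Longrightarrow> Ck_on k E M f"
proof (induction k arbitrary: f)
  case 0
  then show ?case
    by (auto simp: continuous_on_eq_continuous_within intro: has_derivative_continuous)
next
  case (Suc k)
  then obtain D where D: "\<forall>z\<in>M. (f has_derivative D z) (at z within M)"
    "\<forall>v\<in>E. Ck_on (Suc k) E M (\<lambda>z. D z v)"
    by (auto simp only: Ck_on.simps(2)[of "Suc k"])
  with Suc.IH have "\<forall>v\<in>E. Ck_on k E M (\<lambda>z. D z v)" by blast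
  with D(1) show ?case by auto
qed

lemma Ck_on_SucI:
  assumes "\<And>z. z \<in> M \<Longrightarrow> (f has_derivative D z) (at z within M)"
    and "\<And>v. v \<in> E \<Longrightarrow> Ck_on k E M (\<lambda>z. D z v)"
  shows "Ck_on (Suc k) E M f"
  using assms by auto

lemma Ck_on_const: "Ck_on k E M (\<lambda>z. c)"
proof (induction k arbitrary: c)
  case (Suc k)
  then show ?case by (intro Ck_on_SucI[where D = "\<lambda>z v. 0"]) auto
qed simp

lemma Ck_on_bounded_linear:
  assumes "bounded_linear f"
  shows "Ck_on k E M f"
proof (cases k)
  case 0
  with assms show ?thesis by (simp add: linear_continuous_on)
next
  case (Suc l)
  have "Ck_on (Suc l) E M f"
    by (rule Ck_on_SucI[where D = "\<lambda>z. f"])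
      (auto intro: bounded_linear_imp_has_derivative assms Ck_on_const)
  with Suc show ?thesis by simp
qed

lemma Ck_on_bounded_linear_compose:
  assumes "bounded_linear h" "Ck_on k E M f"
  shows "Ck_on k E M (\<lambda>z. h (f z))"
  using assms(2)
proof (induction k arbitrary: f)
  case 0
  then show ?case using bounded_linear.continuous_on[OF assms(1)] by simp
next
  case (Suc k)
  then obtain D where D: "\<forall>z\<in>M. (f has_derivative D z) (at z within M)"
    "\<forall>v\<in>E. Ck_on k E M (\<lambda>z. D z v)"
    by auto
  show ?case
    by (rule Ck_on_SucI[where D = "\<lambda>z v. h (D z v)"])
      (use D Suc.IH in \<open>auto intro: bounded_linear.has_derivative[OF assms(1)]\<close>)
qed

lemma Ck_on_add:
  assumes "Ck_on k E M f" "Ck_on k E M g"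
  shows "Ck_on k E M (\<lambda>z. f z + g z)"
  using assms
proof (induction k arbitrary: f g)
  case 0
  then show ?case by (simp add: continuous_on_add)
next
  case (Suc k)
  then obtain D D' where "\<forall>z\<in>M. (f has_derivative D z) (at z within M)"
    "\<forall>v\<in>E. Ck_on k E M (\<lambda>z. D z v)" "\<forall>z\<in>M. (g has_derivative D' z) (at z within M)"
    "\<forall>v\<in>E. Ck_on k E M (\<lambda>z. D' z v)"
    by auto
  then show ?case
    by (intro Ck_on_SucI[where D = "\<lambda>z v. D z v + D' z v"]) (use Suc.IH in \<open>auto intro: has_derivative_add\<close>)
qed

lemma Ck_on_bilinear:
  assumes "bounded_bilinear b" "Ck_on k E M f" "Ck_on k E M g"
  shows "Ck_on k E M (\<lambda>z. b (f z) (g z))"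
  using assms(2,3)
proof (induction k arbitrary: f g)
  case 0
  then show ?case by (simp add: bounded_bilinear.continuous_on[OF assms(1)])
next
  case (Suc k)
  \<comment> \<open>The product rule leaves one factor undifferentiated in each summand, so the
    induction hypothesis also needs \<open>f\<close> and \<open>g\<close> themselves at order
    \<open>k\<close>.\<close>
  then have fg: "Ck_on k E M f" "Ck_on k E M g" by (blast intro: Ck_on_Suc_imp)+
  from Suc obtain D D' where "\<forall>z\<in>M. (f has_derivative D z) (at z within M)"
    "\<forall>v\<in>E. Ck_on k E M (\<lambda>z. D z v)" "\<forall>z\<in>M. (g has_derivative D' z) (at z within M)"
    "\<forall>v\<in>E. Ck_on k E M (\<lambda>z. D' z v)"
    by auto
  with fg show ?case
    by (intro Ck_on_SucI[where D = "\<lambda>z v. b (f z) (D' z v) + b (D z v) (g z)"])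
      (use Suc.IH in \<open>auto intro!: bounded_bilinear.FDERIV[OF assms(1)] Ck_on_add\<close>)
qed

text \<open>Relative openness of \<open>M\<close> in \<open>E\<close> keeps the line through
  \<open>z\<close> in a direction of \<open>E\<close> inside \<open>M\<close> for all small t, so a
  derivative within \<open>M\<close> restricts to a two-sided derivative in t. \<open>M\<close> need
  not have interior points in the ambient space.\<close>

lemma has_vector_derivative_line:
  assumes "subspace E" "openin (top_of_set E) M" "z \<in> M" "u \<in> E"
    and "(f has_derivative D) (at z within M)"
  shows "((\<lambda>t. f (z + t *\<^sub>R u)) has_vector_derivative D u) (at 0)"
proof -
  obtain U where U: "open U" "M = E \<inter> U" using assms(2) by (auto simp: openin_open)
  let ?l = "\<lambda>t::real. z + t *\<^sub>R u"
  let ?T = "?l -` U"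
  have "open ?T" by (intro open_vimage U continuous_intros)
  have "0 \<in> ?T" using assms(3) U by auto
  have "?l ` ?T \<subseteq> M"
    using assms(1,3,4) U by (auto intro!: subspace_add subspace_scale)
  have l: "(?l has_derivative (\<lambda>t. t *\<^sub>R u)) (at 0 within ?T)"
    by (auto intro!: derivative_eq_intros)
  have "(f has_derivative D) (at (?l 0) within ?l ` ?T)"
    using assms(5) \<open>?l ` ?T \<subseteq> M\<close> by (auto intro: has_derivative_subset)
  from has_derivative_in_compose[OF l this]
  have "((\<lambda>t. f (?l t)) has_derivative (\<lambda>t. D (t *\<^sub>R u))) (at 0 within ?T)" .
  moreover have "D (t *\<^sub>R u) = t *\<^sub>R D u" for t
    using has_derivative_linear[OF assms(5)] by (rule linear_scale)
  moreover have "at 0 within ?T = at 0"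
    using \<open>0 \<in> ?T\<close> \<open>open ?T\<close> by (rule at_within_open)
  ultimately show ?thesis
    by (simp add: has_vector_derivative_def)
qed

lemma dir_deriv_eq:
  assumes "subspace E" "openin (top_of_set E) M" "z \<in> M" "u \<in> E"
    and "(f has_derivative D) (at z within M)"
  shows "dir_deriv f z u = D u"
  unfolding dir_deriv_def using has_vector_derivative_line[OF assms] by (rule vector_derivative_at)

section \<open>The Siegel upper half space\<close>

lemma transpose_scaleR: "transpose (c *\<^sub>R A) = c *\<^sub>R transpose A"
  by (simp add: transpose_def vec_eq_iff)

lemma transpose_add: "transpose (A + B) = transpose A + transpose B"
  by (simp add: transpose_def vec_eq_iff)

lemma transpose_map_matrix: "transpose (map_matrix f A) = map_matrix f (transpose A)"
  by (simp add: transpose_def vec_eq_iff)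

lemma subspace_Symm: "subspace (Symm :: ('a::real_normed_vector ^ 'n ^ 'n) set)"
  unfolding subspace_def Symm_def
  by (auto simp: transpose_add transpose_scaleR) (simp add: transpose_def vec_eq_iff)

lemma map_matrix_Symm: "A \<in> Symm \<Longrightarrow> map_matrix f A \<in> Symm"
  by (simp add: Symm_def transpose_map_matrix)

lemma matrix_inv_Symm:
  fixes A :: "real ^ 'n ^ 'n"
  assumes "A \<in> Symm" "det A \<noteq> 0"
  shows "matrix_inv A \<in> Symm"
proof -
  have inv: "A ** matrix_inv A = mat 1" "matrix_inv A ** A = mat 1"
    using assms by (simp_all add: matrix_inv_right_left invertible_det_nz)
  have "transpose (A ** matrix_inv A) = mat 1"
    by (simp add: inv transpose_mat)
  then have t: "transpose (matrix_inv A) ** A = mat 1"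
    using assms(1) by (simp add: matrix_transpose_mul Symm_def)
  have "transpose (matrix_inv A) = transpose (matrix_inv A) ** (A ** matrix_inv A)"
    by (simp add: inv)
  also have "\<dots> = matrix_inv A"
    by (simp only: matrix_mul_assoc t matrix_mul_lid)
  finally show ?thesis by (simp add: Symm_def)
qed

lemma bounded_linear_map_matrix_Im: "bounded_linear (map_matrix Im :: complex ^ 'n ^ 'n \<Rightarrow> _)"
  unfolding linear_conv_bounded_linear[symmetric] by (auto intro!: linearI simp: vec_eq_iff)

lemma bounded_linear_map_matrix_of_real:
  "bounded_linear (map_matrix of_real :: real ^ 'n ^ 'n \<Rightarrow> complex ^ 'n ^ 'n)"
  unfolding linear_conv_bounded_linear[symmetric]
  by (rule linearI; simp add: vec_eq_iff complex_eq_iff)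

section \<open>Positive definite matrices: determinant and openness\<close>

definition positive_definite :: "real ^ 'n ^ 'n \<Rightarrow> bool" where
  "positive_definite A \<longleftrightarrow> (\<forall>x. x \<noteq> 0 \<longrightarrow> x \<bullet> (A *v x) > 0)"

lemma det_nz_positive_definite:
  fixes A :: "real ^ 'n ^ 'n"
  assumes "positive_definite A"
  shows "det A \<noteq> 0"
proof -
  have "\<forall>x. A *v x = 0 \<longrightarrow> x = 0"
    using assms unfolding positive_definite_def by (metis inner_zero_right less_irrefl)
  then have "\<exists>B. B ** A = mat 1" by (simp add: matrix_left_invertible_ker)
  then show ?thesis by (metis invertible_det_nz invertible_left_inverse)
qed

text \<open>The segment from the identity to \<open>A\<close> consists of positive definite matrices, so the
  determinant does not change sign along it.\<close>

lemma det_pos_positive_definite: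
  fixes A :: "real ^ 'n ^ 'n"
  assumes "positive_definite A"
  shows "det A > 0"
proof (rule ccontr)
  assume "\<not> det A > 0"
  let ?p = "\<lambda>t::real. (1 - t) *\<^sub>R (mat 1 :: real^'n^'n) + t *\<^sub>R A"
  have pd: "positive_definite (?p t)" if "0 \<le> t" "t \<le> 1" for t
    unfolding positive_definite_def
  proof (intro allI impI)
    fix x :: "real^'n" assume x: "x \<noteq> 0"
    have "x \<bullet> (?p t *v x) = (1 - t) * (x \<bullet> x) + t * (x \<bullet> (A *v x))"
      by (simp add: matrix_vector_mult_add_rdistrib scaleR_matrix_vector_assoc[symmetric] inner_add_right)
    moreover have "x \<bullet> x > 0" "x \<bullet> (A *v x) > 0"
      using x assms by (auto simp: positive_definite_def)
    moreover have "(1 - t) * (x \<bullet> x) \<ge> 0" "t * (x \<bullet> (A *v x)) \<ge> 0"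
      using that \<open>x \<bullet> x > 0\<close> \<open>x \<bullet> (A *v x) > 0\<close> by auto
    moreover have "(1 - t) * (x \<bullet> x) > 0 \<or> t * (x \<bullet> (A *v x)) > 0"
      using that \<open>x \<bullet> x > 0\<close> \<open>x \<bullet> (A *v x) > 0\<close> by (cases "t = 0") auto
    ultimately show "x \<bullet> (?p t *v x) > 0" by linarith
  qed
  have "isCont (\<lambda>t. det (?p t)) t" for t
    by (rule continuous_at_compose[unfolded o_def, OF _ continuous_det]) (intro continuous_intros)
  then have "\<exists>t\<ge>0. t \<le> 1 \<and> det (?p t) = 0"
    using \<open>\<not> det A > 0\<close> by (intro IVT2) auto
  with pd det_nz_positive_definite show False by blast
qed

text \<open>The quadratic form of \<open>A\<close> attains a minimum m > 0 on the compact unit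
  sphere. If K bounds matrix-vector multiplication, a perturbation of norm below m / K changes the
  form by less than m on the sphere; homogeneity extends positivity to all nonzero vectors.\<close>

lemma open_positive_definite: "open {A :: real ^ 'n ^ 'n. positive_definite A}"
  unfolding open_dist
proof (intro ballI)
  fix A :: "real ^ 'n ^ 'n" assume "A \<in> {A. positive_definite A}"
  then have A: "\<And>x. x \<noteq> 0 \<Longrightarrow> x \<bullet> (A *v x) > 0" by (simp add: positive_definite_def)
  interpret mv: bounded_bilinear "(*v) :: real^'n^'n \<Rightarrow> real^'n \<Rightarrow> real^'n"
    by (rule bounded_bilinear_matrix_vector_mult)
  obtain K where K: "K > 0" "\<forall>(X :: real^'n^'n) (y :: real^'n). norm (X *v y) \<le> norm X * norm y * K"
    using mv.pos_bounded by (elim exE conjE)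
  obtain e :: "real^'n" where e: "norm e = 1" using vector_choose_size[of 1] by auto
  have "continuous_on (sphere 0 1) (\<lambda>x. x \<bullet> (A *v x))"
    by (intro continuous_intros mv.continuous_on)
  moreover have "sphere (0 :: real^'n) 1 \<noteq> {}" using e by auto
  ultimately obtain x0 where x0: "x0 \<in> sphere 0 1"
    "\<forall>x\<in>sphere 0 1. x0 \<bullet> (A *v x0) \<le> x \<bullet> (A *v x)"
    using continuous_attains_inf[OF compact_sphere] by blast
  define m where "m = x0 \<bullet> (A *v x0)"
  have m: "m > 0" unfolding m_def using x0(1) by (intro A) auto
  show "\<exists>e>0. \<forall>B. dist B A < e \<longrightarrow> B \<in> {A. positive_definite A}"
  proof (intro exI conjI allI impI)
    show "m / K > 0" using m K by simp
    fix B assume B: "dist B A < m / K"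
    have unit: "x \<bullet> (B *v x) > 0" if "norm x = 1" for x
    proof -
      have "\<bar>x \<bullet> ((B - A) *v x)\<bar> \<le> norm x * norm ((B - A) *v x)" by (rule Cauchy_Schwarz_ineq2)
      also have "\<dots> \<le> norm x * (norm (B - A) * norm x * K)"
        using K(2) by (intro mult_left_mono) auto
      also have "\<dots> = norm (B - A) * K" using that by simp
      also have "\<dots> < m" using B K(1) by (simp add: dist_norm pos_less_divide_eq)
      finally have "\<bar>x \<bullet> ((B - A) *v x)\<bar> < m" .
      moreover have "m \<le> x \<bullet> (A *v x)" using x0(2) that by (simp add: m_def)
      moreover have "x \<bullet> (B *v x) = x \<bullet> (A *v x) + x \<bullet> ((B - A) *v x)"
        by (simp add: mv.diff_left inner_diff_right)
      ultimately show ?thesis by linarith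
    qed
    have "x \<bullet> (B *v x) > 0" if "x \<noteq> 0" for x
    proof -
      have "(sgn x) \<bullet> (B *v sgn x) > 0" using that by (intro unit) (simp add: norm_sgn)
      moreover have "(sgn x) \<bullet> (B *v sgn x) = (inverse (norm x))\<^sup>2 * (x \<bullet> (B *v x))"
        by (simp add: sgn_div_norm mv.scaleR_right power2_eq_square)
      ultimately show ?thesis using that by (simp add: zero_less_mult_iff)
    qed
    then show "B \<in> {A. positive_definite A}" by (simp add: positive_definite_def)
  qed
qed

lemma siegel_iff: "Z \<in> siegel \<longleftrightarrow> Z \<in> Symm \<and> positive_definite (map_matrix Im Z)"
  by (simp add: siegel_def positive_definite_def)

lemma openin_siegel: "openin (top_of_set Symm) siegel"
proof -
  have "siegel = Symm \<inter> map_matrix Im -` {A. positive_definite A}"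
    by (auto simp: siegel_iff)
  moreover have "open (map_matrix Im -` {A :: real^'n^'n. positive_definite A})"
    by (intro open_vimage open_positive_definite linear_continuous_on bounded_linear_map_matrix_Im)
  ultimately show ?thesis by (metis openin_open_Int)
qed

lemma siegelD:
  assumes "Z \<in> siegel"
  shows "Z \<in> Symm" "det (map_matrix Im Z) > 0" "matrix_inv (map_matrix Im Z) \<in> Symm"
    "map_matrix Im Z ** matrix_inv (map_matrix Im Z) = mat 1"
    "matrix_inv (map_matrix Im Z) ** map_matrix Im Z = mat 1"
proof -
  show Z: "Z \<in> Symm" and d: "det (map_matrix Im Z) > 0"
    using assms by (auto simp: siegel_iff det_pos_positive_definite)
  with d show "map_matrix Im Z ** matrix_inv (map_matrix Im Z) = mat 1"
    "matrix_inv (map_matrix Im Z) ** map_matrix Im Z = mat 1"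
    by (simp_all add: matrix_inv_right_left invertible_det_nz)
  show "matrix_inv (map_matrix Im Z) \<in> Symm"
    using d by (intro matrix_inv_Symm map_matrix_Symm Z) auto
qed

section \<open>Smooth dependence of the inverse of Im(Z) on Z\<close>

lemma has_derivative_inv_Im:
  assumes "Z \<in> siegel"
  shows "((\<lambda>Y. matrix_inv (map_matrix Im Y)) has_derivative
    (\<lambda>u. - (matrix_inv (map_matrix Im Z) ** map_matrix Im u ** matrix_inv (map_matrix Im Z))))
    (at Z within S)"
  using siegelD(2)[OF assms]
  by (intro has_derivative_compose[OF bounded_linear_imp_has_derivative[OF bounded_linear_map_matrix_Im]
        has_derivative_matrix_inv]) simp

text \<open>The derivative -F Im(v) F is a polynomial in F itself, so order k+1 reduces to order k
  and the induction closes.\<close>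

lemma Ck_on_inv_Im: "Ck_on k Symm siegel (\<lambda>Z :: complex ^ 'n ^ 'n. matrix_inv (map_matrix Im Z))"
proof (induction k)
  case 0
  show ?case
    by (auto simp: continuous_on_eq_continuous_within
        intro: has_derivative_continuous[OF has_derivative_inv_Im])
next
  case (Suc k)
  show ?case
  proof (rule Ck_on_SucI[OF has_derivative_inv_Im])
    fix v :: "complex ^ 'n ^ 'n"
    show "Ck_on k Symm siegel (\<lambda>Z. - (matrix_inv (map_matrix Im Z) ** map_matrix Im v **
        matrix_inv (map_matrix Im Z)))"
      by (intro Ck_on_bounded_linear_compose[OF bounded_linear_minus[OF bounded_linear_ident]]
          Ck_on_bilinear[OF bounded_bilinear_matrix_matrix_mult] Ck_on_const Suc)
  qed
qed

section \<open>The potential log K(Z,Z) and its first derivative\<close>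

lemma det_map_matrix_of_real: "det (map_matrix of_real A) = of_real (det A)"
  by (simp add: det_def)

lemma det_scaleR: "det (c *\<^sub>R (A :: real ^ 'n ^ 'n)) = c ^ CARD('n) * det A"
  by (simp add: det_def prod.distrib sum_distrib_left ac_simps)

text \<open>The matrix inside the determinant is the real matrix 2 Im(Z), since Z minus its
  conjugate is 2i Im(Z). The kernel is thus a positive real and the principal branch is the real
  logarithm; the term n ln 2 comes from the factor 2^n of the determinant.\<close>

lemma Ln_bergman_kernel:
  fixes Z :: "complex ^ 'n ^ 'n"
  assumes "Z \<in> siegel"
  shows "Ln (bergman_kernel Z Z) =
    of_real (- real (CARD('n) + 1) * (real CARD('n) * ln 2 + ln (det (map_matrix Im Z))))"
proof -
  let ?d = "2 ^ CARD('n) * det (map_matrix Im Z)"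
  have d: "?d > 0" using siegelD(2)[OF assms] by simp
  have "map_matrix (\<lambda>c. - \<i> * c) (Z - map_matrix cnj Z) = map_matrix of_real (2 *\<^sub>R map_matrix Im Z)"
    by (simp add: vec_eq_iff complex_eq_iff)
  then have "bergman_kernel Z Z = of_real (inverse (?d ^ (CARD('n) + 1)))"
    by (simp only: bergman_kernel_def det_map_matrix_of_real det_scaleR of_real_power of_real_inverse)
  also have "Ln \<dots> = of_real (ln (inverse (?d ^ (CARD('n) + 1))))"
    using d by (intro Ln_of_real) (simp only: inverse_positive_iff_positive zero_less_power)
  also have "ln (inverse (?d ^ (CARD('n) + 1))) = - real (CARD('n) + 1) * ln ?d"
    using d by (simp only: ln_inverse zero_less_power ln_realpow)
  also have "ln ?d = real CARD('n) * ln 2 + ln (det (map_matrix Im Z))"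
    using siegelD(2)[OF assms] by (simp add: ln_mult ln_realpow)
  finally show ?thesis .
qed

lemma has_derivative_Ln_bergman_kernel:
  fixes Z :: "complex ^ 'n ^ 'n"
  assumes "Z \<in> siegel"
  shows "((\<lambda>Y. Ln (bergman_kernel Y Y)) has_derivative
    (\<lambda>u. of_real (- real (CARD('n) + 1) * trace (matrix_inv (map_matrix Im Z) ** map_matrix Im u))))
    (at Z within siegel)"
proof (rule has_derivative_transform[OF assms])
  show "Ln (bergman_kernel Y Y) =
    of_real (- real (CARD('n) + 1) * (real CARD('n) * ln 2 + ln (det (map_matrix Im Y))))"
    if "Y \<in> siegel" for Y :: "complex ^ 'n ^ 'n"
    using that by (rule Ln_bergman_kernel)
  have d: "det (map_matrix Im Z) > 0" by (rule siegelD[OF assms])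
  have "((\<lambda>Y. det (map_matrix Im Y)) has_derivative (\<lambda>u. det (map_matrix Im Z) *
      trace (matrix_inv (map_matrix Im Z) ** map_matrix Im u))) (at Z within siegel)"
    using d
    by (intro has_derivative_compose[OF bounded_linear_imp_has_derivative[OF bounded_linear_map_matrix_Im]
          has_derivative_det]) simp
  from has_derivative_ln[OF d this]
  have "((\<lambda>Y. ln (det (map_matrix Im Y))) has_derivative
      (\<lambda>u. trace (matrix_inv (map_matrix Im Z) ** map_matrix Im u))) (at Z within siegel)"
    using d by (simp add: field_simps)
  from has_derivative_mult_right[OF has_derivative_add[OF has_derivative_const this]]
  show "((\<lambda>Y. complex_of_real (- real (CARD('n) + 1) *
      (real CARD('n) * ln 2 + ln (det (map_matrix Im Y))))) has_derivative
    (\<lambda>u. of_real (- real (CARD('n) + 1) * trace (matrix_inv (map_matrix Im Z) ** map_matrix Im u))))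
    (at Z within siegel)"
    by (intro has_derivative_of_real) (simp only: add_0)
qed

section \<open>The Kaehler form\<close>

text \<open>These are the matrices E_lm of the coordinate formula; those with l \<le> m form a basis
  of the real symmetric matrices. Both off-diagonal entries equal 1, so the coefficients are plain
  matrix entries.\<close>

definition sym_unit :: "'n \<Rightarrow> 'n \<Rightarrow> real ^ 'n ^ 'n" where
  "sym_unit l m = (\<chi> i j. if (i = l \<and> j = m) \<or> (i = m \<and> j = l) then 1 else 0)"

lemma coord_vec_Symm: "coord_vec c l m \<in> Symm"
  by (auto simp: Symm_def coord_vec_def transpose_def vec_eq_iff)

lemma Im_coord_vec: "map_matrix Im (coord_vec 1 l m) = 0"
  "map_matrix Im (coord_vec \<i> l m) = sym_unit l m"
  by (auto simp: coord_vec_def sym_unit_def vec_eq_iff)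

lemma Symm_eq_sum_sym_unit:
  fixes A :: "real ^ 'n::{finite,linorder} ^ 'n::{finite,linorder}"
  assumes "A \<in> Symm"
  shows "A = (\<Sum>(l, m) \<in> {(l, m). l \<le> m}. A $ l $ m *\<^sub>R sym_unit l m)"
proof -
  have sym: "A $ i $ j = A $ j $ i" for i j
    using assms by (auto simp: Symm_def transpose_def vec_eq_iff)
  have "(\<Sum>(l, m) \<in> {(l, m). l \<le> m}. A $ l $ m *\<^sub>R sym_unit l m) $ i $ j = A $ i $ j" for i j
  proof -
    \<comment> \<open>Only the ordered pair (min i j, max i j) contributes to the entry (i,
      j).\<close>
    have "(\<Sum>(l, m) \<in> {(l, m). l \<le> m}. A $ l $ m *\<^sub>R sym_unit l m) $ i $ j
        = (\<Sum>p \<in> {(l, m). l \<le> m}. if p = (min i j, max i j) then A $ fst p $ snd p else 0)"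
      unfolding sum_component
    proof (rule sum.cong[OF refl], clarify)
      fix l m :: 'n assume "l \<le> m"
      then have "(i = l \<and> j = m) \<or> (i = m \<and> j = l) \<longleftrightarrow> (l, m) = (min i j, max i j)"
        by (cases "i \<le> j") (auto simp: min_def max_def)
      then show "(A $ l $ m *\<^sub>R sym_unit l m) $ i $ j
          = (if (l, m) = (min i j, max i j) then A $ fst (l, m) $ snd (l, m) else 0)"
        by (simp only: sym_unit_def vector_scaleR_component vec_lambda_beta fst_conv snd_conv) simp
    qed
    also have "\<dots> = A $ min i j $ max i j"
      using min_le_iff_disj[of i j "max i j"] by (subst sum.delta) auto
    also have "\<dots> = A $ i $ j" using sym by (auto simp: min_def max_def)
    finally show ?thesis .
  qed
  then show ?thesis by (simp add: vec_eq_iff)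
qed

text \<open>Expanding both arguments in the basis \<open>sym_unit\<close> shows that the coordinate
  double sum of the metric is a coordinate-free bilinear form.\<close>

lemma bounded_bilinear_sum_sym_unit:
  fixes \<beta> :: "real ^ 'n::{finite,linorder} ^ 'n::{finite,linorder} \<Rightarrow> real ^ 'n::{finite,linorder} ^ 'n::{finite,linorder} \<Rightarrow> real"
  assumes "bounded_bilinear \<beta>" "A \<in> Symm" "B \<in> Symm"
  shows "(\<Sum>(l, m) \<in> {(l, m). l \<le> m}. \<Sum>(j, k) \<in> {(j, k). j \<le> k}.
    \<beta> (sym_unit l m) (sym_unit j k) * A $ l $ m * B $ j $ k) = \<beta> A B"
proof -
  interpret bounded_bilinear \<beta> by (rule assms)
  have "\<beta> A B = \<beta> (\<Sum>(l, m) \<in> {(l, m). l \<le> m}. A $ l $ m *\<^sub>R sym_unit l m)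
      (\<Sum>(j, k) \<in> {(j, k). j \<le> k}. B $ j $ k *\<^sub>R sym_unit j k)"
    using Symm_eq_sum_sym_unit[OF assms(2)] Symm_eq_sum_sym_unit[OF assms(3)] by simp
  also have "\<dots> = (\<Sum>(l, m) \<in> {(l, m). l \<le> m}. \<Sum>(j, k) \<in> {(j, k). j \<le> k}.
    \<beta> (sym_unit l m) (sym_unit j k) * A $ l $ m * B $ j $ k)"
    unfolding case_prod_unfold
    by (subst sum_left, subst sum_right) (simp add: scaleR_left scaleR_right ac_simps)
  finally show ?thesis by simp
qed

text \<open>The derivative along \<open>coord_vec 1 j k\<close> vanishes, because that direction has
  imaginary part 0; what remains is i/2 times the derivative along
  \<open>coord_vec \<i> j k\<close>.\<close>

lemma d_dzbar_Ln_bergman_kernel: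
  fixes Z :: "complex ^ 'n ^ 'n"
  assumes "Z \<in> siegel"
  shows "d_dzbar j k (\<lambda>Y. Ln (bergman_kernel Y Y)) Z =
    - \<i> * of_real (real (CARD('n) + 1) / 2 * trace (matrix_inv (map_matrix Im Z) ** sym_unit j k))"
proof -
  note * = dir_deriv_eq[OF subspace_Symm openin_siegel assms coord_vec_Symm
      has_derivative_Ln_bergman_kernel[OF assms]]
  show ?thesis
    unfolding d_dzbar_def * Im_coord_vec by (simp add: complex_eq_iff algebra_simps)
qed

lemma bounded_linear_trace_mult_right:
  "bounded_linear (\<lambda>X. trace ((X :: real ^ 'n ^ 'n) ** A))"
  by (rule bounded_linear_compose[OF bounded_linear_trace
        bounded_bilinear.bounded_linear_left[OF bounded_bilinear_matrix_matrix_mult]])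

text \<open>The constant is (-i/2) * (-i (n+1)/2) * (-1), the last sign coming from the derivative
  of the inverse.\<close>

lemma d_dz_d_dzbar_Ln_bergman_kernel:
  fixes Z :: "complex ^ 'n ^ 'n"
  assumes "Z \<in> siegel"
  shows "d_dz l m (d_dzbar j k (\<lambda>Y. Ln (bergman_kernel Y Y))) Z =
    of_real (real (CARD('n) + 1) / 4 * trace (matrix_inv (map_matrix Im Z) ** sym_unit l m **
      matrix_inv (map_matrix Im Z) ** sym_unit j k))"
proof -
  let ?F = "matrix_inv (map_matrix Im Z)"
  have "((\<lambda>Y. - \<i> * of_real (real (CARD('n) + 1) / 2 *
        trace (matrix_inv (map_matrix Im Y) ** sym_unit j k))) has_derivative
      (\<lambda>u. - \<i> * of_real (real (CARD('n) + 1) / 2 *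
        trace (- (?F ** map_matrix Im u ** ?F) ** sym_unit j k)))) (at Z within siegel)"
    by (intro has_derivative_mult_right has_derivative_of_real
        bounded_linear.has_derivative[OF bounded_linear_trace_mult_right] has_derivative_inv_Im assms)
  then have "(d_dzbar j k (\<lambda>Y. Ln (bergman_kernel Y Y)) has_derivative
      (\<lambda>u. - \<i> * of_real (real (CARD('n) + 1) / 2 *
        trace (- (?F ** map_matrix Im u ** ?F) ** sym_unit j k)))) (at Z within siegel)"
    by (rule has_derivative_transform[OF assms d_dzbar_Ln_bergman_kernel, rotated])
  note * = dir_deriv_eq[OF subspace_Symm openin_siegel assms coord_vec_Symm this]
  show ?thesis
    unfolding d_dz_def * Im_coord_vec
    by (simp add: matrix_mult_minus_left trace_uminus field_simps)
qed

lemma kaehler_form_eq: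
  fixes Z U V :: "complex ^ 'n::{finite,linorder} ^ 'n::{finite,linorder}"
  assumes "Z \<in> siegel" "U \<in> Symm" "V \<in> Symm"
  defines "F \<equiv> matrix_inv (map_matrix Im Z)"
  shows "kaehler_form Z U V =
    2 * trace (F ** map_matrix Re U ** F ** map_matrix Im V)
    - 2 * trace (F ** map_matrix Im U ** F ** map_matrix Re V)"
proof -
  let ?\<beta> = "\<lambda>A B. trace (F ** A ** F ** B)"
  let ?P = "{(l :: 'n, m). l \<le> m}"
  have bb: "bounded_bilinear ?\<beta>"
    unfolding bilinear_conv_bounded_bilinear[symmetric] bilinear_def
    by (auto intro!: linearI simp: matrix_mult_add_left matrix_mult_add_right matrix_mult_scaleR_left
        matrix_mult_scaleR_right trace_add trace_scaleR)
  \<comment> \<open>Here the normalisation 4/(n+1) of the metric cancels the factor (n+1)/4 of the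
    mixed derivatives.\<close>
  have scale: "4 / of_nat N * (of_real (real N / 4 * x) * u * v) = of_real x * u * v"
    if "N \<noteq> 0" for N :: nat and x and u v :: complex
    using that by (simp add: field_simps)
  have N: "CARD('n) + 1 \<noteq> 0" by simp
  \<comment> \<open>The coefficients of the metric are real, so its imaginary part splits into two
    real bilinear sums.\<close>
  have Im_term: "Im (of_real x * u * cnj v) = x * Im u * Re v - x * Re u * Im v" for x u v
    by (simp add: algebra_simps)
  have "bergman_metric Z U V = (\<Sum>(l, m) \<in> ?P. \<Sum>(j, k) \<in> ?P.
      of_real (?\<beta> (sym_unit l m) (sym_unit j k)) * U $ l $ m * cnj (V $ j $ k))"
    unfolding bergman_metric_def d_dz_d_dzbar_Ln_bergman_kernel[OF assms(1)] F_def case_prod_unfold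
      sum_distrib_left scale[OF N] ..
  then have "Im (bergman_metric Z U V) = (\<Sum>(l, m) \<in> ?P. \<Sum>(j, k) \<in> ?P.
      ?\<beta> (sym_unit l m) (sym_unit j k) * map_matrix Im U $ l $ m * map_matrix Re V $ j $ k
      - ?\<beta> (sym_unit l m) (sym_unit j k) * map_matrix Re U $ l $ m * map_matrix Im V $ j $ k)"
    by (simp only: case_prod_unfold Im_sum Im_term nth_map_matrix)
  also have "\<dots> = ?\<beta> (map_matrix Im U) (map_matrix Re V) - ?\<beta> (map_matrix Re U) (map_matrix Im V)"
    using bounded_bilinear_sum_sym_unit[OF bb map_matrix_Symm[OF assms(2)] map_matrix_Symm[OF assms(3)]]
    by (simp only: case_prod_unfold sum_subtractf)
  finally show ?thesis by (simp add: kaehler_form_def)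
qed

section \<open>Linearity, skew-symmetry, nondegeneracy and smoothness of the form\<close>

lemma kaehler_form_invariant:
  assumes "Z \<in> siegel" "W \<in> siegel" "U \<in> Symm" "V \<in> Symm" "map_matrix Im Z = map_matrix Im W"
  shows "kaehler_form Z U V = kaehler_form W U V"
  using assms by (simp add: kaehler_form_eq)

lemma kaehler_form_linear:
  assumes "Z \<in> siegel" "U \<in> Symm" "V \<in> Symm" "W \<in> Symm"
  shows "kaehler_form Z (a *\<^sub>R U + b *\<^sub>R V) W = a * kaehler_form Z U W + b * kaehler_form Z V W"
proof -
  have "a *\<^sub>R U + b *\<^sub>R V \<in> Symm"
    by (intro subspace_add[OF subspace_Symm] subspace_scale[OF subspace_Symm] assms)
  moreover have "map_matrix Re (a *\<^sub>R U + b *\<^sub>R V) = a *\<^sub>R map_matrix Re U + b *\<^sub>R map_matrix Re V"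
    "map_matrix Im (a *\<^sub>R U + b *\<^sub>R V) = a *\<^sub>R map_matrix Im U + b *\<^sub>R map_matrix Im V"
    by (simp_all add: vec_eq_iff)
  ultimately show ?thesis
    using assms
    by (simp add: kaehler_form_eq matrix_mult_add_left matrix_mult_add_right matrix_mult_scaleR_left
        matrix_mult_scaleR_right trace_add trace_scaleR algebra_simps)
qed

text \<open>Cyclicity of the trace for the two blocks \<open>F ** A\<close> and
  \<open>F ** B\<close>. This symmetry makes the Kaehler form skew.\<close>

lemma trace_mult_swap:
  "trace (F ** A ** F ** B) = trace (F ** B ** F ** (A :: real ^ 'n ^ 'n))"
  by (metis matrix_mul_assoc trace_mul_sym)

lemma kaehler_form_skew:
  assumes "Z \<in> siegel" "U \<in> Symm" "V \<in> Symm"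
  shows "kaehler_form Z U V = - kaehler_form Z V U"
proof -
  let ?F = "matrix_inv (map_matrix Im Z)"
  show ?thesis
    using trace_mult_swap[of ?F "map_matrix Re U" "map_matrix Im V"]
      trace_mult_swap[of ?F "map_matrix Im U" "map_matrix Re V"]
    by (simp add: kaehler_form_eq assms)
qed

text \<open>For symmetric \<open>A\<close> this is the squared Frobenius norm, the source of
  positivity both for nondegeneracy and for the trace pairing.\<close>

lemma trace_square_Symm:
  fixes A :: "real ^ 'n ^ 'n"
  assumes "A \<in> Symm"
  shows "trace (A ** A) = (\<Sum>i\<in>UNIV. \<Sum>j\<in>UNIV. (A $ i $ j)\<^sup>2)"
proof -
  have "A $ i $ j = A $ j $ i" for i j
    using assms by (auto simp: Symm_def transpose_def vec_eq_iff)
  then show ?thesis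
    by (auto simp: trace_def matrix_matrix_mult_def power2_eq_square intro!: sum.cong)
qed

lemma trace_square_Symm_pos:
  fixes A :: "real ^ 'n ^ 'n"
  assumes "A \<in> Symm"
  shows "trace (A ** A) \<ge> 0" "trace (A ** A) = 0 \<Longrightarrow> A = 0"
  by (auto simp: trace_square_Symm[OF assms] sum_nonneg sum_nonneg_eq_0_iff vec_eq_iff)

lemma kaehler_form_nondegenerate:
  fixes Z U :: "complex ^ 'n::{finite,linorder} ^ 'n::{finite,linorder}"
  assumes Z: "Z \<in> siegel" and U: "U \<in> Symm" and z: "\<forall>V\<in>Symm. kaehler_form Z U V = 0"
  shows "U = 0"
proof -
  let ?Y = "map_matrix Im Z" and ?R = "map_matrix Re U" and ?I = "map_matrix Im U"
  let ?F = "matrix_inv ?Y"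
  \<comment> \<open>The test direction is V = i Y U Y, with real part \<open>B\<close> and imaginary
    part \<open>A\<close>. The factors Y cancel the factors F in the form, and multiplication by i
    pairs Re(U) and Im(U) each with itself with the same sign.\<close>
  define A where "A = ?Y ** ?R ** ?Y"
  define B where "B = - (?Y ** ?I ** ?Y)"
  define V :: "complex ^ 'n::{finite,linorder} ^ 'n::{finite,linorder}" where "V = (\<chi> i j. Complex (B $ i $ j) (A $ i $ j))"
  have tr: "transpose ?Y = ?Y" "transpose ?R = ?R" "transpose ?I = ?I"
    using U siegelD(1)[OF Z] by (simp_all add: Symm_def transpose_map_matrix)
  have "transpose A = A" "transpose (- B) = - B"
    unfolding A_def B_def by (simp_all add: matrix_transpose_mul tr matrix_mul_assoc)
  then have "A $ i $ j = A $ j $ i" "B $ i $ j = B $ j $ i" for i j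
    by (auto simp: transpose_def vec_eq_iff)
  then have "V \<in> Symm" unfolding V_def Symm_def transpose_def by (simp add: vec_eq_iff)
  have V: "map_matrix Re V = B" "map_matrix Im V = A" by (simp_all add: V_def vec_eq_iff)
  have FXF: "trace (?F ** X ** ?F ** (?Y ** X ** ?Y)) = trace (X ** X)" for X
  proof -
    have "trace (?F ** X ** ?F ** (?Y ** X ** ?Y)) = trace (?F ** (X ** (?F ** ?Y) ** X ** ?Y))"
      by (simp only: matrix_mul_assoc)
    also have "\<dots> = trace (X ** X ** ?Y ** ?F)"
      by (simp only: siegelD(5)[OF Z] matrix_mul_rid trace_mul_sym[of ?F])
    also have "X ** X ** ?Y ** ?F = X ** X ** (?Y ** ?F)" by (simp only: matrix_mul_assoc)
    finally show ?thesis by (simp only: siegelD(4)[OF Z] matrix_mul_rid)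
  qed
  have "kaehler_form Z U V = 2 * trace (?R ** ?R) + 2 * trace (?I ** ?I)"
    unfolding kaehler_form_eq[OF Z U \<open>V \<in> Symm\<close>] V A_def B_def
    by (simp add: matrix_mult_minus_right trace_uminus FXF)
  then have "trace (?R ** ?R) + trace (?I ** ?I) = 0"
    using z \<open>V \<in> Symm\<close> by simp
  moreover have S: "?R \<in> Symm" "?I \<in> Symm" using U by (simp_all add: map_matrix_Symm)
  ultimately have "trace (?R ** ?R) = 0" "trace (?I ** ?I) = 0"
    using trace_square_Symm_pos(1)[OF S(1)] trace_square_Symm_pos(1)[OF S(2)] by linarith+
  then have "?R = 0" "?I = 0" using S trace_square_Symm_pos(2) by blast+
  then show "U = 0" by (simp add: vec_eq_iff complex_eq_iff)
qed

lemma Ck_on_trace_inv_Im: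
  "Ck_on k Symm siegel (\<lambda>Z :: complex ^ 'n ^ 'n.
    trace (matrix_inv (map_matrix Im Z) ** A ** matrix_inv (map_matrix Im Z) ** B))"
  by (intro Ck_on_bounded_linear_compose[OF bounded_linear_trace]
      Ck_on_bilinear[OF bounded_bilinear_matrix_matrix_mult] Ck_on_const Ck_on_inv_Im)

lemma smooth_kaehler_form:
  assumes "U \<in> Symm" "V \<in> Symm"
  shows "smooth_map_on Symm siegel (\<lambda>Z. kaehler_form Z U V)"
  unfolding smooth_map_on_def
proof
  fix k
  have "Ck_on k Symm siegel (\<lambda>Z.
      2 * trace (matrix_inv (map_matrix Im Z) ** map_matrix Re U ** matrix_inv (map_matrix Im Z) ** map_matrix Im V) +
      (- 2) * trace (matrix_inv (map_matrix Im Z) ** map_matrix Im U ** matrix_inv (map_matrix Im Z) ** map_matrix Re V))"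
    by (intro Ck_on_add Ck_on_bounded_linear_compose[OF bounded_linear_mult_right] Ck_on_trace_inv_Im)
  then show "Ck_on k Symm siegel (\<lambda>Z. kaehler_form Z U V)"
    by (rule Ck_on_cong[THEN iffD1, rotated]) (simp add: kaehler_form_eq assms)
qed

section \<open>Closedness of the form\<close>

lemma has_derivative_trace_inv_Im:
  fixes Z :: "complex ^ 'n ^ 'n"
  assumes "Z \<in> siegel"
  defines "F \<equiv> matrix_inv (map_matrix Im Z)"
  shows "((\<lambda>Y. trace (matrix_inv (map_matrix Im Y) ** A ** (matrix_inv (map_matrix Im Y) ** B)))
    has_derivative (\<lambda>u. trace (F ** A ** (- (F ** map_matrix Im u ** F) ** B)
      + (- (F ** map_matrix Im u ** F) ** A) ** (F ** B)))) (at Z within siegel)"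
  unfolding F_def
  by (intro bounded_linear.has_derivative[OF bounded_linear_trace]
      bounded_bilinear.FDERIV[OF bounded_bilinear_matrix_matrix_mult]
      bounded_linear.has_derivative[OF bounded_bilinear.bounded_linear_left[OF
          bounded_bilinear_matrix_matrix_mult]] has_derivative_inv_Im assms)

text \<open>Invariance under cyclic shifts and under transposition makes
  \<open>tr (F A F B F C)\<close> a totally symmetric function of the symmetric matrices \<open>A\<close>, \<open>B\<close>, \<open>C\<close>.\<close>

lemma trace_triple_cyclic:
  "trace (F ** A ** F ** B ** F ** C) = trace (F ** B ** F ** C ** F ** (A :: real ^ 'n ^ 'n))"
proof -
  have "trace (F ** A ** F ** B ** F ** C) = trace ((F ** A) ** (F ** B ** F ** C))"
    by (simp only: matrix_mul_assoc)
  also have "\<dots> = trace ((F ** B ** F ** C) ** (F ** A))" by (rule trace_mul_sym)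
  finally show ?thesis by (simp only: matrix_mul_assoc)
qed

lemma trace_triple_reverse:
  fixes F :: "real ^ 'n ^ 'n"
  assumes "F \<in> Symm" "A \<in> Symm" "B \<in> Symm" "C \<in> Symm"
  shows "trace (F ** A ** F ** B ** F ** C) = trace (F ** C ** F ** B ** F ** A)"
proof -
  have "trace (F ** A ** F ** B ** F ** C) = trace (transpose (F ** A ** F ** B ** F ** C))"
    by (simp add: trace_transpose)
  also have "transpose (F ** A ** F ** B ** F ** C) = (C ** F ** B ** F ** A) ** F"
    using assms by (simp add: Symm_def matrix_transpose_mul matrix_mul_assoc)
  also have "trace \<dots> = trace (F ** (C ** F ** B ** F ** A))" by (rule trace_mul_sym)
  finally show ?thesis by (simp only: matrix_mul_assoc)
qed

text \<open>Reversal takes ABC to CBA, and two cyclic shifts take CBA through BAC to ACB.\<close>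

lemma trace_triple_swap:
  fixes F :: "real ^ 'n ^ 'n"
  assumes "F \<in> Symm" "A \<in> Symm" "B \<in> Symm" "C \<in> Symm"
  shows "trace (F ** A ** F ** B ** F ** C) = trace (F ** A ** F ** C ** F ** B)"
  using trace_triple_reverse[OF assms] trace_triple_cyclic[of F C B A] trace_triple_cyclic[of F B A C]
  by simp

text \<open>The derivative hits either of the two factors F, and symmetry of the triple traces makes
  both contributions equal; this doubles the factor 2 to 4. Both traces are arranged with the
  direction first and the real part last, ready for cancellation in the cyclic sum.\<close>

lemma dir_deriv_kaehler_form:
  fixes Z U V W :: "complex ^ 'n::{finite,linorder} ^ 'n::{finite,linorder}"
  assumes Z: "Z \<in> siegel" and U: "U \<in> Symm" and V: "V \<in> Symm" and W: "W \<in> Symm"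
  defines "F \<equiv> matrix_inv (map_matrix Im Z)"
  shows "dir_deriv (\<lambda>Y. kaehler_form Y V W) Z U =
    4 * trace (F ** map_matrix Im U ** F ** map_matrix Im V ** F ** map_matrix Re W)
    - 4 * trace (F ** map_matrix Im U ** F ** map_matrix Im W ** F ** map_matrix Re V)"
proof -
  let ?F = "\<lambda>Y. matrix_inv (map_matrix Im Y)"
  let ?D = "\<lambda>A B u. trace (F ** A ** (- (F ** map_matrix Im u ** F) ** B)
      + (- (F ** map_matrix Im u ** F) ** A) ** (F ** B))"
  note S = map_matrix_Symm[OF U, of Im] map_matrix_Symm[OF V, of Im] map_matrix_Symm[OF W, of Im]
    map_matrix_Symm[OF V, of Re] map_matrix_Symm[OF W, of Re]
  have F: "F \<in> Symm" unfolding F_def by (rule siegelD[OF Z])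
  have "((\<lambda>Y. 2 * trace (?F Y ** map_matrix Re V ** (?F Y ** map_matrix Im W))
      - 2 * trace (?F Y ** map_matrix Im V ** (?F Y ** map_matrix Re W))) has_derivative
      (\<lambda>u. 2 * ?D (map_matrix Re V) (map_matrix Im W) u - 2 * ?D (map_matrix Im V) (map_matrix Re W) u))
      (at Z within siegel)"
    unfolding F_def
    by (intro has_derivative_diff has_derivative_mult_right has_derivative_trace_inv_Im Z)
  then have "((\<lambda>Y. kaehler_form Y V W) has_derivative
      (\<lambda>u. 2 * ?D (map_matrix Re V) (map_matrix Im W) u - 2 * ?D (map_matrix Im V) (map_matrix Re W) u))
      (at Z within siegel)"
    by (rule has_derivative_transform[OF Z, rotated])
      (simp add: kaehler_form_eq V W matrix_mul_assoc)
  from dir_deriv_eq[OF subspace_Symm openin_siegel Z U this]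
  have "dir_deriv (\<lambda>Y. kaehler_form Y V W) Z U =
      2 * ?D (map_matrix Re V) (map_matrix Im W) U - 2 * ?D (map_matrix Im V) (map_matrix Re W) U" .
  moreover have "?D A B U = - 2 * trace (F ** map_matrix Im U ** F ** B ** F ** A)"
    if "A \<in> Symm" "B \<in> Symm" for A B
  proof -
    have "?D A B U = - trace (F ** A ** F ** map_matrix Im U ** F ** B)
        - trace (F ** map_matrix Im U ** F ** A ** F ** B)"
      by (simp add: matrix_mult_minus_left matrix_mult_minus_right trace_add trace_uminus trace_sub
          matrix_mul_assoc)
    also have "trace (F ** A ** F ** map_matrix Im U ** F ** B)
        = trace (F ** map_matrix Im U ** F ** B ** F ** A)"
      by (rule trace_triple_cyclic)
    also have "trace (F ** map_matrix Im U ** F ** A ** F ** B)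
        = trace (F ** map_matrix Im U ** F ** B ** F ** A)"
      by (rule trace_triple_swap[OF F S(1) that])
    finally show ?thesis by simp
  qed
  ultimately show ?thesis using S trace_triple_swap[OF F S(1,2,5)] by simp
qed

text \<open>In the cyclic sum every trace tr (F Im(A) F Im(B) F Re(C)) meets its counterpart with A
  and B exchanged and the opposite sign.\<close>

lemma kaehler_form_closed:
  fixes Z U V W :: "complex ^ 'n::{finite,linorder} ^ 'n::{finite,linorder}"
  assumes Z: "Z \<in> siegel" and U: "U \<in> Symm" and V: "V \<in> Symm" and W: "W \<in> Symm"
  shows "dir_deriv (\<lambda>Y. kaehler_form Y V W) Z U + dir_deriv (\<lambda>Y. kaehler_form Y W U) Z V
    + dir_deriv (\<lambda>Y. kaehler_form Y U V) Z W = 0"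
proof -
  let ?F = "matrix_inv (map_matrix Im Z)"
  have sym: "trace (?F ** map_matrix Im A ** ?F ** map_matrix Im B ** ?F ** map_matrix Re C)
      = trace (?F ** map_matrix Im B ** ?F ** map_matrix Im A ** ?F ** map_matrix Re C)"
    if "A \<in> Symm" "B \<in> Symm" "C \<in> Symm" for A B C
    using trace_triple_swap[OF siegelD(3)[OF Z] map_matrix_Symm[OF that(1), of Im]
        map_matrix_Symm[OF that(2), of Im] map_matrix_Symm[OF that(3), of Re]]
      trace_triple_cyclic[of ?F "map_matrix Im B" "map_matrix Im A" "map_matrix Re C"]
    by simp
  show ?thesis
    unfolding dir_deriv_kaehler_form[OF Z U V W] dir_deriv_kaehler_form[OF Z V W U]
      dir_deriv_kaehler_form[OF Z W U V]
    using sym[OF U V W] sym[OF V W U] sym[OF W U V] by simp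
qed

lemma symplectic_manifold_siegel: "symplectic_manifold Symm siegel kaehler_form"
  unfolding symplectic_manifold_def
  by (intro conjI ballI allI impI subspace_Symm openin_siegel kaehler_form_linear smooth_kaehler_form
      kaehler_form_closed) (assumption | rule kaehler_form_skew | rule kaehler_form_nondegenerate)+

section \<open>The parabolic action\<close>

lemma parabolic_action_siegel:
  assumes "S \<in> Symm" "Z \<in> siegel"
  shows "parabolic_action S Z \<in> siegel" "map_matrix Im (parabolic_action S Z) = map_matrix Im Z"
proof -
  show Im: "map_matrix Im (parabolic_action S Z) = map_matrix Im Z"
    by (simp add: parabolic_action_def vec_eq_iff)
  have "parabolic_action S Z \<in> Symm"
    using assms(1) siegelD(1)[OF assms(2)] subspace_Symm
    by (auto simp: parabolic_action_def intro!: subspace_add map_matrix_Symm)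
  with Im assms(2) show "parabolic_action S Z \<in> siegel" by (simp add: siegel_iff)
qed

text \<open>Jointly in both arguments the action is a bounded linear map.\<close>

lemma smooth_parabolic_action: "smooth_map_on E M (\<lambda>(S, Z :: complex ^ 'n ^ 'n). parabolic_action S Z)"
proof -
  have "bounded_linear (\<lambda>p :: (real ^ 'n ^ 'n) \<times> (complex ^ 'n ^ 'n). snd p + map_matrix of_real (fst p))"
    by (intro bounded_linear_add bounded_linear_snd
        bounded_linear_compose[OF bounded_linear_map_matrix_of_real bounded_linear_fst])
  then show ?thesis
    by (simp add: smooth_map_on_def case_prod_unfold parabolic_action_def Ck_on_bounded_linear)
qed

lemma dir_deriv_parabolic_action: "dir_deriv (parabolic_action S) Z U = U"
proof -
  have "((\<lambda>t. Z + t *\<^sub>R U + map_matrix of_real S) has_vector_derivative U) (at 0)"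
    by (auto intro!: derivative_eq_intros)
  then show ?thesis unfolding dir_deriv_def parabolic_action_def by (rule vector_derivative_at)
qed

lemma fundamental_field_parabolic_action: "fundamental_field parabolic_action X Z = map_matrix of_real X"
proof -
  have "((\<lambda>s. Z + s *\<^sub>R map_matrix of_real X) has_vector_derivative map_matrix of_real X) (at 0)"
    by (auto intro!: derivative_eq_intros)
  then show ?thesis
    unfolding fundamental_field_def parabolic_action_def
      linear_scale[OF bounded_linear.linear[OF bounded_linear_map_matrix_of_real]]
    by (rule vector_derivative_at)
qed

lemma symplectic_parabolic_action:
  "symplectic_vector_group_action Symm parabolic_action Symm siegel kaehler_form"
  unfolding symplectic_vector_group_action_def
proof (intro conjI ballI)
  fix S :: "real ^ 'n::{finite,linorder} ^ 'n::{finite,linorder}"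
    and Z U V :: "complex ^ 'n::{finite,linorder} ^ 'n::{finite,linorder}"
  assume "S \<in> Symm" "Z \<in> siegel" "U \<in> Symm" "V \<in> Symm"
  then show "kaehler_form (parabolic_action S Z) (dir_deriv (parabolic_action S) Z U)
      (dir_deriv (parabolic_action S) Z V) = kaehler_form Z U V"
    unfolding dir_deriv_parabolic_action
    by (intro kaehler_form_invariant parabolic_action_siegel)
next
  show "parabolic_action (S + T) Z = parabolic_action S (parabolic_action T Z)"
    for S T :: "real ^ 'n::{finite,linorder} ^ 'n::{finite,linorder}" and Z
    by (simp add: parabolic_action_def vec_eq_iff)
  show "parabolic_action 0 Z = Z" for Z :: "complex ^ 'n::{finite,linorder} ^ 'n::{finite,linorder}"
    by (simp add: parabolic_action_def vec_eq_iff)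
qed (rule subspace_Symm smooth_parabolic_action | erule (1) parabolic_action_siegel)+

section \<open>The trace pairing and the moment map equation\<close>

lemma inner_product_on_trace: "inner_product_on Symm (\<lambda>A B :: real ^ 'n ^ 'n. trace (A ** B))"
  unfolding inner_product_on_def
proof (intro conjI ballI allI impI)
  fix A :: "real ^ 'n ^ 'n" assume "A \<in> Symm" "A \<noteq> 0"
  then have "trace (A ** A) \<noteq> 0" using trace_square_Symm_pos(2) by blast
  with trace_square_Symm_pos(1)[OF \<open>A \<in> Symm\<close>] show "trace (A ** A) > 0" by linarith
next
  show "trace (A ** B) = trace (B ** A)" for A B :: "real ^ 'n ^ 'n" by (rule trace_mul_sym)
qed (simp add: matrix_mult_add_left matrix_mult_scaleR_left trace_add trace_scaleR)

theorem proposition4p8: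
  shows "moment_map
    (Symm :: (real ^ 'n::{finite,linorder} ^ 'n::{finite,linorder}) set)
    (\<lambda>A B. trace (A ** B))
    parabolic_action
    Symm siegel kaehler_form
    (\<lambda>Z. - 2 *\<^sub>R matrix_inv (map_matrix Im Z))"
  unfolding moment_map_def
proof (intro conjI ballI)
  fix X :: "real ^ 'n::{finite,linorder} ^ 'n::{finite,linorder}"
    and Z :: "complex ^ 'n::{finite,linorder} ^ 'n::{finite,linorder}"
  assume X: "X \<in> Symm" and Z: "Z \<in> siegel"
  let ?F = "matrix_inv (map_matrix Im Z)"
  let ?D = "\<lambda>V. trace ((- 2 *\<^sub>R (- (?F ** map_matrix Im V ** ?F))) ** X)"
  have "((\<lambda>Y. trace ((- 2 *\<^sub>R matrix_inv (map_matrix Im Y)) ** X)) has_derivative ?D) (at Z within siegel)"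
    by (intro bounded_linear.has_derivative[OF bounded_linear_trace_mult_right]
        has_derivative_scaleR_right has_derivative_inv_Im Z)
  moreover have "?D V = kaehler_form Z (fundamental_field parabolic_action X Z) V" if V: "V \<in> Symm" for V
  proof -
    \<comment> \<open>The fundamental field is the constant real matrix X, so the second trace of
      the form vanishes. In the first, cyclicity moves X to the end, where the pairing with -2 dF(V)
      has it.\<close>
    have RI: "map_matrix Re (map_matrix of_real X) = X" "map_matrix Im (map_matrix of_real X) = 0"
      by (simp_all add: vec_eq_iff)
    have "kaehler_form Z (map_matrix of_real X) V = 2 * trace (?F ** X ** ?F ** map_matrix Im V)"
      unfolding kaehler_form_eq[OF Z map_matrix_Symm[OF X] V] RI by simp
    also have "\<dots> = ?D V"
      unfolding trace_mult_swap[of ?F X]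
      by (simp add: matrix_mult_scaleR_left matrix_mult_minus_left trace_scaleR)
    finally show ?thesis by (simp add: fundamental_field_parabolic_action)
  qed
  ultimately show "\<exists>D. ((\<lambda>Y. trace ((- 2 *\<^sub>R matrix_inv (map_matrix Im Y)) ** X)) has_derivative D)
      (at Z within siegel) \<and>
      (\<forall>V\<in>Symm. D V = kaehler_form Z (fundamental_field parabolic_action X Z) V)"
    by blast
next
  show "smooth_map_on Symm siegel (\<lambda>Z :: complex ^ 'n::{finite,linorder} ^ 'n::{finite,linorder}. - 2 *\<^sub>R matrix_inv (map_matrix Im Z))"
    unfolding smooth_map_on_def
    by (intro allI Ck_on_bounded_linear_compose[OF bounded_linear_scaleR_right] Ck_on_inv_Im)
next
  fix Z :: "complex ^ 'n::{finite,linorder} ^ 'n::{finite,linorder}" assume "Z \<in> siegel"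
  then show "- 2 *\<^sub>R matrix_inv (map_matrix Im Z) \<in> Symm"
    by (intro subspace_scale[OF subspace_Symm] siegelD(3))
next
  fix S :: "real ^ 'n::{finite,linorder} ^ 'n::{finite,linorder}"
    and Z :: "complex ^ 'n::{finite,linorder} ^ 'n::{finite,linorder}"
  assume "S \<in> Symm" "Z \<in> siegel"
  then show "- 2 *\<^sub>R matrix_inv (map_matrix Im (parabolic_action S Z)) =
      - 2 *\<^sub>R matrix_inv (map_matrix Im Z)"
    by (simp only: parabolic_action_siegel(2))
qed (rule symplectic_manifold_siegel symplectic_parabolic_action inner_product_on_trace)+

end
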